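(* Let $k$, $n$ and $s$ be positive integers and let $x_1,\ldots,x_n$ be independent variables. Then $$H_k^{(s)}(x_1,\ldots,x_n)=\sum_{\substack{\lambda\vdash k\\ \lambda_i\equiv 0\text{ or }1\ (\mathrm{mod}\ s+1)\ \forall i}}(-1)^{k+\sum_{i=1}^{\ell(\lambda)}(\lambda_i\bmod (s+1))}\,m_\lambda(x_1,\ldots,x_n),$$ where the sum is over partitions $\lambda$ of $k$ all of whose parts are congruent to $0$ or $1$ modulo $s+1$, and $\lambda_i\bmod(s+1)$ denotes the least nonnegative residue.
   Context: For a positive integer $s$, $H_k^{(s)}$ ($k\ge0$) is defined by the formal power series identity $$\sum_{k\ge0}H_k^{(s)}(x_1,\ldots,x_n)t^k=\prod_{i=1}^n\big(1-x_it+\cdots+(-x_it)^s\big)^{-1}.$$ $m_\lambda$ is the monomial symmetric function (zero if $\ell(\lambda)>n$) and $\ell(\lambda)$ is the number of parts of $\lambda$. *)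

theory Defs
  imports
    "HOL-Library.Poly_Mapping"
    "HOL-Computational_Algebra.Formal_Power_Series"
    "HOL-Combinatorics.Multiset_Permutations"
    "HOL-Number_Theory.Cong"
begin

text \<open>
  Polynomials over a commutative ring \<open>'a\<close> in the independent variables \<open>X i\<close> are
  finitely supported maps from monomials (finitely supported exponent functions) to coefficients.
  The ring has one variable for each natural number; a statement about n variables
  mentions only \<open>X 1, \<dots>, X n\<close>.
\<close>

type_synonym 'a mpolynomial = "(nat \<Rightarrow>\<^sub>0 nat) \<Rightarrow>\<^sub>0 'a"

definition X :: "nat \<Rightarrow> 'a::comm_ring_1 mpolynomial" where
  "X i = Poly_Mapping.single (Poly_Mapping.single i 1) 1"

text \<open>The series \<open>1 - x t + \<dots> + (- x t)^s\<close> in \<open>t = fps_X\<close>.\<close>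

definition H_factor :: "nat \<Rightarrow> 'a::comm_ring_1 \<Rightarrow> 'a fps" where
  "H_factor s x = (\<Sum>j\<le>s. (- (fps_const x * fps_X)) ^ j)"

text \<open>
  Since the coefficients need not form a field, the reciprocal of a series with constant term 1
  is written \<open>fps_right_inverse _ 1\<close>.
\<close>

definition H :: "nat \<Rightarrow> nat \<Rightarrow> nat \<Rightarrow> (nat \<Rightarrow> 'a::comm_ring_1) \<Rightarrow> 'a" where
  "H s k n x = fps_nth (\<Prod>i=1..n. fps_right_inverse (H_factor s (x i)) 1) k"

definition partitions_of :: "nat \<Rightarrow> nat list set" where
  "partitions_of k = {p. sorted_wrt (\<ge>) p \<and> (\<forall>a\<in>set p. 0 < a) \<and> sum_list p = k}"

text \<open>
  The monomial symmetric function: the sum of \<open>x_1 ^ \<alpha>_1 \<cdots> x_n ^ \<alpha>_n\<close> over all distinct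
  rearrangements \<open>\<alpha>\<close> of the partition padded with zeros to length n.
\<close>

definition monomial_sym :: "nat list \<Rightarrow> nat \<Rightarrow> (nat \<Rightarrow> 'a::comm_ring_1) \<Rightarrow> 'a" where
  "monomial_sym p n x =
    (if length p > n then 0
     else (\<Sum>\<alpha>\<in>permutations_of_multiset (mset (p @ replicate (n - length p) 0)).
             \<Prod>i=1..n. x i ^ (\<alpha> ! (i - 1))))"

lemma H_factor_nth_0 [simp]: "fps_nth (H_factor s x) 0 = 1"
proof -
  have "fps_nth (H_factor s x) 0 = (\<Sum>j\<le>s. 0 ^ j)"
    by (simp add: H_factor_def fps_sum_nth fps_power_zeroth)
  also have "\<dots> = 1"
    by (induction s) auto
  finally show ?thesis .
qed

lemma H_generating_function:
  "Abs_fps (\<lambda>k. H s k n x) * (\<Prod>i=1..n. H_factor s (x i)) = 1"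
proof -
  have "Abs_fps (\<lambda>k. H s k n x) = (\<Prod>i=1..n. fps_right_inverse (H_factor s (x i)) 1)"
    by (simp add: H_def fps_nth_inverse)
  moreover have "fps_right_inverse (H_factor s (x i)) 1 * H_factor s (x i) = 1" for i
    using fps_right_inverse[of "H_factor s (x i)" 1] by (simp add: mult.commute)
  ultimately show ?thesis
    by (simp add: prod.distrib[symmetric])
qed

lemma finite_partitions_of: "finite (partitions_of k)"
proof -
  have "length p \<le> sum_list p" if "\<forall>a\<in>set p. 0 < a" for p :: "nat list"
    using that by (induction p) auto
  then have "partitions_of k \<subseteq> {p. set p \<subseteq> {..k} \<and> length p \<le> k}"
    by (auto simp: partitions_of_def dest: member_le_sum_list)
  then show ?thesis
    by (rule finite_subset) (rule finite_lists_length_le, simp)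
qed

end

theory Submission
  imports Defs
begin

text \<open>
  Summing the geometric series turns the reciprocal of \<open>1 - x t + \<dots> + (- x t)^s\<close> into
  \<open>(1 + x t) / (1 - (- x t)^(s+1))\<close>, in which only exponents congruent to 0 or 1 modulo
  \<open>s + 1\<close> survive. Expanding the product over the variables and collecting the exponent
  sequences with the same nonzero entries gives the monomial symmetric functions.
\<close>

text \<open>This is the coefficient of \<open>(x t)^a\<close> in the reciprocal of
  \<open>H_factor s x\<close>. The value 0 in the other residue classes lets sums run over all
  exponents and all partitions.\<close>

definition residue_sign :: "nat \<Rightarrow> nat \<Rightarrow> 'a::comm_ring_1" where
  "residue_sign s a =
    (if [a = 0] (mod (s + 1)) \<or> [a = 1] (mod (s + 1)) then (- 1) ^ (a + a mod (s + 1)) else 0)"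

lemma residue_sign_0 [simp]: "residue_sign s 0 = 1"
  by (simp add: residue_sign_def)

lemma residue_sign_small:
  assumes "s > 0" "a \<le> s"
  shows "residue_sign s a = (if a = 0 \<or> a = 1 then 1 else 0)"
  using assms by (auto simp: residue_sign_def cong_def)

text \<open>The shift preserves the residue, so only the sign changes; this is the recurrence
  imposed by the denominator \<open>1 - (- x t)^(s+1)\<close>.\<close>

lemma residue_sign_add_period: "residue_sign s (Suc s + a) = (- 1) ^ Suc s * residue_sign s a"
proof -
  have "(Suc s + a) mod Suc s = a mod Suc s"
    by (rule mod_add_self1)
  then show ?thesis
    unfolding residue_sign_def cong_def Suc_eq_plus1[symmetric] by (simp add: power_add)
qed

text \<open>With \<open>z = - x t\<close>, the product \<open>(1 - z) * H_factor s x * g\<close>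
  equals \<open>(1 - z ^ Suc s) * g\<close>, which telescopes to \<open>1 - z\<close>; then
  \<open>1 - z\<close> is cancelled.\<close>

lemma H_factor_mult_residue_sign:
  fixes x :: "'a::comm_ring_1"
  assumes "s > 0"
  shows "H_factor s x * Abs_fps (\<lambda>a. residue_sign s a * x ^ a) = 1"
proof -
  define z where "z = - (fps_const x * fps_X)"
  define g where "g = Abs_fps (\<lambda>a. residue_sign s a * x ^ a)"
  have z: "z = fps_const (- x) * fps_X"
    unfolding z_def by (simp flip: fps_const_neg)
  \<comment> \<open>In this form, multiplication by \<open>z ^ Suc s\<close> shifts coefficients by
    \<open>Suc s\<close> and scales them.\<close>
  have zp: "z ^ m = fps_const ((- x) ^ m) * fps_X ^ m" for m
    unfolding z by (simp only: power_mult_distrib fps_const_power)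
  have "(1 - z ^ Suc s) * g = 1 - z"
  proof (rule fps_ext)
    fix a
    have lhs: "fps_nth ((1 - z ^ Suc s) * g) a =
        fps_nth g a - (if a < Suc s then 0 else (- x) ^ Suc s * fps_nth g (a - Suc s))"
      unfolding zp left_diff_distrib
      by (simp only: mult.assoc mult_1_left fps_sub_nth fps_mult_left_const_nth
          fps_X_power_mult_nth) simp
    have rhs: "fps_nth (1 - z) a = (if a = 0 then 1 else if a = 1 then x else 0)"
      unfolding z by simp
    show "fps_nth ((1 - z ^ Suc s) * g) a = fps_nth (1 - z) a"
    proof (cases "a \<le> s")
      case True
      then show ?thesis
        unfolding lhs rhs using residue_sign_small[OF assms True, where 'a = 'a]
        by (simp add: g_def)
    next
      case False
      \<comment> \<open>Since \<open>s > 0\<close>, here \<open>a\<close> is at least 2, so the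
        right side vanishes and the claim is the recurrence for \<open>g\<close>.\<close>
      then obtain b where b: "a = Suc s + b"
        using less_eqE[of "Suc s" a] by (metis not_less_eq_eq)
      have "(- x) ^ Suc s = (- 1) ^ Suc s * x ^ Suc s"
        by (rule power_minus)
      then have "fps_nth g a = (- x) ^ Suc s * fps_nth g b"
        unfolding g_def b fps_nth_Abs_fps residue_sign_add_period power_add
        by (simp only: ac_simps)
      then show ?thesis
        unfolding lhs rhs using assms b by simp
    qed
  qed
  moreover have "(1 - z) * H_factor s x = 1 - z ^ Suc s"
    unfolding H_factor_def z_def[symmetric] by (rule sum_gp_basic)
  ultimately have *: "(1 - z) * (H_factor s x * g) = 1 - z"
    by (simp add: mult.assoc[symmetric])
  \<comment> \<open>The ring may have zero divisors, but \<open>1 - z\<close> has constant term 1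
    and is invertible.\<close>
  have "fps_right_inverse (1 - z) 1 * (1 - z) = 1"
    using fps_right_inverse[of "1 - z" 1] by (simp add: z_def mult.commute)
  then have "H_factor s x * g = fps_right_inverse (1 - z) 1 * ((1 - z) * (H_factor s x * g))"
    by (simp add: mult.assoc[symmetric])
  also have "\<dots> = 1"
    unfolding * by fact
  finally show ?thesis
    unfolding g_def .
qed

text \<open>Inverses in a commutative ring are unique: evaluate
  \<open>?r * H_factor s x * ?g\<close> in two ways.\<close>

lemma fps_right_inverse_H_factor:
  fixes x :: "'a::comm_ring_1"
  assumes "s > 0"
  shows "fps_right_inverse (H_factor s x) 1 = Abs_fps (\<lambda>a. residue_sign s a * x ^ a)"
    (is "?r = ?g")
proof -
  have "H_factor s x * ?r = 1"
    by (rule fps_right_inverse) simp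
  then have "?r = ?r * (H_factor s x * ?g)" "?g = (H_factor s x * ?r) * ?g"
    by (simp_all add: H_factor_mult_residue_sign[OF assms])
  then show ?thesis
    by (simp add: ac_simps)
qed

text \<open>The partition underlying an exponent sequence; \<open>rev\<close> gives the weakly
  decreasing order of \<open>partitions_of\<close>.\<close>

definition positive_parts :: "nat list \<Rightarrow> nat list" where
  "positive_parts \<alpha> = rev (sort (filter (\<lambda>a. 0 < a) \<alpha>))"

lemma positive_parts_in_partitions_of: "positive_parts \<alpha> \<in> partitions_of (sum_list \<alpha>)"
proof -
  have "sum_list (filter (\<lambda>a. 0 < a) \<alpha>) = sum_list \<alpha>"
    by (induction \<alpha>) auto
  moreover have "sum_list (positive_parts \<alpha>) = sum_list (filter (\<lambda>a. 0 < a) \<alpha>)"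
    by (metis mset_rev mset_sort positive_parts_def sum_mset_sum_list)
  ultimately show ?thesis
    by (auto simp: partitions_of_def positive_parts_def sorted_wrt_rev)
qed

lemma mset_positive_parts:
  "mset \<alpha> = mset (positive_parts \<alpha> @ replicate (length \<alpha> - length (positive_parts \<alpha>)) 0)"
proof (induction \<alpha>)
  case Nil
  then show ?case by (simp add: positive_parts_def)
next
  case (Cons a \<alpha>)
  then show ?case
    \<comment> \<open>This bound keeps the truncated subtraction exact when a zero is
      prepended.\<close>
    using length_filter_le[of "\<lambda>a. 0 < a" \<alpha>]
    by (auto simp: positive_parts_def Suc_diff_le)
qed

text \<open>Identifies the fibre of \<open>positive_parts\<close> over \<open>p\<close> with the
  rearrangements summed in \<open>monomial_sym\<close>. A partition is sorted and has no zero parts,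
  so the padded multiset determines it.\<close>

lemma positive_parts_eq_iff:
  assumes "p \<in> partitions_of k"
  shows "length \<alpha> = n \<and> positive_parts \<alpha> = p \<longleftrightarrow>
    length p \<le> n \<and> mset \<alpha> = mset (p @ replicate (n - length p) 0)" (is "?L \<longleftrightarrow> ?R")
proof
  assume ?L
  moreover have "length (positive_parts \<alpha>) \<le> length \<alpha>"
    by (simp add: positive_parts_def)
  ultimately show ?R
    using mset_positive_parts[of \<alpha>] by auto
next
  assume R: ?R
  then have "length \<alpha> = n"
    by (metis add_diff_inverse_nat length_append length_replicate not_less size_mset)
  moreover have "mset (filter (\<lambda>a. 0 < a) \<alpha>) = mset p"
  proof -
    have "filter (\<lambda>a. 0 < a) (p @ replicate (n - length p) 0) = p"
      using assms by (simp add: partitions_of_def filter_id_conv)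
    moreover have "mset (filter (\<lambda>a. 0 < a) \<alpha>) =
        mset (filter (\<lambda>a. 0 < a) (p @ replicate (n - length p) 0))"
      using R by (simp only: mset_filter)
    ultimately show ?thesis
      by simp
  qed
  then have "sort (filter (\<lambda>a. 0 < a) \<alpha>) = rev p"
    using assms by (intro properties_for_sort) (auto simp: partitions_of_def sorted_wrt_rev)
  ultimately show ?L
    by (simp add: positive_parts_def)
qed

text \<open>The coefficient is a sum over exponent sequences of length \<open>n\<close> and sum
  \<open>k\<close>, grouped by their positive parts. As \<open>c 0 = 1\<close>, padding zeros do not
  affect the weight, which is constant on each group.\<close>

lemma fps_nth_prod_monomial_sym:
  fixes c :: "nat \<Rightarrow> 'a::comm_ring_1"
  assumes c: "c 0 = 1" and "n > 0"
  shows "fps_nth (\<Prod>i=1..n. Abs_fps (\<lambda>a. c a * x i ^ a)) k =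
    (\<Sum>p\<in>partitions_of k. prod_list (map c p) * monomial_sym p n x)"
proof -
  \<comment> \<open>\<open>fps_prod_nth\<close> expands products indexed by \<open>{0..m}\<close>,
    hence the successor form and the index shift.\<close>
  obtain m where n: "n = Suc m"
    using \<open>n > 0\<close> gr0_conv_Suc by blast
  define w where "w \<alpha> = (\<Prod>i=1..n. x i ^ (\<alpha> ! (i - 1)))" for \<alpha>
  let ?A = "natpermute k n"
  have "(\<Prod>i=1..n. Abs_fps (\<lambda>a. c a * x i ^ a)) = (\<Prod>j=0..m. Abs_fps (\<lambda>a. c a * x (Suc j) ^ a))"
    unfolding n by (simp only: One_nat_def prod.shift_bounds_cl_Suc_ivl)
  then have "fps_nth (\<Prod>i=1..n. Abs_fps (\<lambda>a. c a * x i ^ a)) k =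
      (\<Sum>\<alpha>\<in>?A. \<Prod>j=0..m. c (\<alpha> ! j) * x (Suc j) ^ (\<alpha> ! j))"
    by (simp add: fps_prod_nth n)
  also have "\<dots> = (\<Sum>\<alpha>\<in>?A. prod_list (map c \<alpha>) * w \<alpha>)"
  proof (rule sum.cong[OF refl])
    fix \<alpha> assume "\<alpha> \<in> ?A"
    then have "length \<alpha> = Suc m"
      by (simp add: natpermute_def n)
    then have "prod_list (map c \<alpha>) = (\<Prod>j=0..m. c (\<alpha> ! j))"
      by (simp add: prod.list_conv_set_nth atLeastLessThanSuc_atLeastAtMost)
    moreover have "w \<alpha> = (\<Prod>j=0..m. x (Suc j) ^ (\<alpha> ! j))"
      unfolding w_def n by (simp only: One_nat_def prod.shift_bounds_cl_Suc_ivl) simp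
    ultimately show "(\<Prod>j=0..m. c (\<alpha> ! j) * x (Suc j) ^ (\<alpha> ! j)) = prod_list (map c \<alpha>) * w \<alpha>"
      by (simp add: prod.distrib)
  qed
  also have "\<dots> = (\<Sum>p\<in>partitions_of k.
      \<Sum>\<alpha> | \<alpha> \<in> ?A \<and> positive_parts \<alpha> = p. prod_list (map c \<alpha>) * w \<alpha>)"
    using positive_parts_in_partitions_of
    by (intro sum.group[symmetric] natpermute_finite finite_partitions_of)
      (auto simp: natpermute_def)
  also have "\<dots> = (\<Sum>p\<in>partitions_of k. prod_list (map c p) * monomial_sym p n x)"
  proof (rule sum.cong[OF refl])
    fix p assume p: "p \<in> partitions_of k"
    let ?M = "mset (p @ replicate (n - length p) 0)"
    have "sum_list \<alpha> = k" if "mset \<alpha> = ?M" for \<alpha>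
      using p arg_cong[OF that, of sum_mset]
      by (simp add: partitions_of_def sum_mset_sum_list sum_list_replicate)
    then have "\<alpha> \<in> ?A \<and> positive_parts \<alpha> = p \<longleftrightarrow> length p \<le> n \<and> mset \<alpha> = ?M" for \<alpha>
      unfolding natpermute_def using positive_parts_eq_iff[OF p, of \<alpha> n] by blast
    \<comment> \<open>The empty fibre of a partition with too many parts matches the value 0 in
      \<open>monomial_sym\<close>.\<close>
    then have fibre: "{\<alpha>. \<alpha> \<in> ?A \<and> positive_parts \<alpha> = p} =
        (if length p > n then {} else permutations_of_multiset ?M)"
      unfolding permutations_of_multiset_def by auto
    have weight: "prod_list (map c \<alpha>) = prod_list (map c p)" if "mset \<alpha> = ?M" for \<alpha>
    proof -
      have "prod_mset (image_mset c (mset \<alpha>)) = prod_mset (image_mset c (mset p))"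
        unfolding that by (simp add: c)
      then show ?thesis
        by (simp add: prod_mset_prod_list flip: mset_map)
    qed
    show "(\<Sum>\<alpha> | \<alpha> \<in> ?A \<and> positive_parts \<alpha> = p. prod_list (map c \<alpha>) * w \<alpha>) =
        prod_list (map c p) * monomial_sym p n x"
    proof (cases "length p > n")
      case True
      then show ?thesis
        unfolding fibre monomial_sym_def by simp
    next
      case False
      have "(\<Sum>\<alpha>\<in>permutations_of_multiset ?M. prod_list (map c \<alpha>) * w \<alpha>) =
          (\<Sum>\<alpha>\<in>permutations_of_multiset ?M. prod_list (map c p) * w \<alpha>)"
        by (rule sum.cong[OF refl]) (simp only: weight permutations_of_multisetD)
      then show ?thesis
        unfolding fibre monomial_sym_def w_def[symmetric]
        by (simp only: False if_False sum_distrib_left)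
    qed
  qed
  finally show ?thesis .
qed

text \<open>One part in a wrong residue class kills the product; otherwise the exponents of the
  signs add up.\<close>

lemma prod_list_residue_sign:
  "prod_list (map (residue_sign s) p) =
    (if \<forall>a\<in>set p. [a = 0] (mod (s + 1)) \<or> [a = 1] (mod (s + 1))
     then (- 1) ^ (sum_list p + (\<Sum>a\<leftarrow>p. a mod (s + 1))) else 0)"
  by (induction p) (auto simp: residue_sign_def power_add simp del: One_nat_def)

theorem theorem4p4:
  fixes k n s :: nat
  assumes "k > 0" and "n > 0" and "s > 0"
  shows "H s k n (X :: nat \<Rightarrow> 'a::comm_ring_1 mpolynomial) =
    (\<Sum>p | p \<in> partitions_of k \<and> (\<forall>a\<in>set p. [a = 0] (mod (s + 1)) \<or> [a = 1] (mod (s + 1))).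
       (- 1) ^ (k + (\<Sum>a\<leftarrow>p. a mod (s + 1))) * monomial_sym p n X)"
proof -
  let ?X = "X :: nat \<Rightarrow> 'a mpolynomial"
  let ?good = "\<lambda>p. \<forall>a\<in>set p. [a = 0] (mod (s + 1)) \<or> [a = 1] (mod (s + 1))"
  \<comment> \<open>The general expansion is applied with weight \<open>c = residue_sign s\<close>,
    whose value at 0 is 1.\<close>
  have "H s k n ?X = (\<Sum>p\<in>partitions_of k. prod_list (map (residue_sign s) p) * monomial_sym p n ?X)"
    unfolding H_def fps_right_inverse_H_factor[OF \<open>s > 0\<close>]
    by (rule fps_nth_prod_monomial_sym) (use \<open>n > 0\<close> in simp_all)
  also have "\<dots> = (\<Sum>p\<in>partitions_of k. if ?good p
      then (- 1) ^ (k + (\<Sum>a\<leftarrow>p. a mod (s + 1))) * monomial_sym p n ?X else 0)"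
  proof (rule sum.cong[OF refl])
    fix p assume "p \<in> partitions_of k"
    then have "sum_list p = k"
      by (simp add: partitions_of_def)
    then show "prod_list (map (residue_sign s) p) * monomial_sym p n ?X =
        (if ?good p then (- 1) ^ (k + (\<Sum>a\<leftarrow>p. a mod (s + 1))) * monomial_sym p n ?X else 0)"
      by (simp only: prod_list_residue_sign if_distrib[of "\<lambda>y. y * _"] mult_zero_left)
  qed
  also have "\<dots> = (\<Sum>p | p \<in> partitions_of k \<and> ?good p.
      (- 1) ^ (k + (\<Sum>a\<leftarrow>p. a mod (s + 1))) * monomial_sym p n ?X)"
    by (rule sum.inter_filter[OF finite_partitions_of, symmetric])
  finally show ?thesis .
qed

end
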